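(* Let $f\in\mathcal{GMM}_{m+1}$ be a bent function in $2m$ variables. Then $f\in\mathcal{M}$ if and only if $f$ can be written as $f(x',y')=x'\cdot\phi(y')+h(y')$, $x'\in\mathbb{F}_2^{m-1}$, $y'\in\mathbb{F}_2^{m+1}$, where $\phi\colon\mathbb{F}_2^{m+1}\to\mathbb{F}_2^{m-1}$ and $h\colon\mathbb{F}_2^{m+1}\to\mathbb{F}_2$ are such that (0) $\{\phi^{-1}(a)\mid a\in\mathbb{F}_2^{m-1}\}$ is a partition of $\mathbb{F}_2^{m+1}$ into $2$-dimensional affine subspaces, and for every $a\in\mathbb{F}_2^{m-1}$ the restriction of $h$ to $\phi^{-1}(a)$ has odd weight; and, in addition, the following two conditions hold: (1) the $4$-to-$1$ mapping $\phi$ depends only on the last $m$ variables (so $\phi(0,y)=\phi(1,y)=:\phi(y)$ for all $y\in\mathbb{F}_2^m$); (2) the Boolean function $h'$ on $\mathbb{F}_2^m$ defined by $h'(y):=h(0,y)+h(1,y)$, for all $y\in\mathbb{F}_2^m$, is balanced and extends $\phi(y)=(\phi_1(y),\ldots,\phi_{m-1}(y))$ to a permutation of $\mathbb{F}_2^m$, i.e., $y\mapsto(\phi_1(y),\ldots,\phi_{m-1}(y),h'(y))$ is a permutation of $\mathbb{F}_2^m$.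
   Context: $m$ is a positive integer and "$\cdot$" is the standard dot product over $\mathbb{F}_2$. For $n$ even, $f\colon\mathbb{F}_2^n\to\mathbb{F}_2$ is bent if $\sum_{x\in\mathbb{F}_2^n}(-1)^{f(x)+\omega\cdot x}=\pm2^{n/2}$ for all $\omega\in\mathbb{F}_2^n$. A Boolean function is balanced if it takes the values $0$ and $1$ equally often; the weight of a Boolean function restricted to a set is the number of points of the set where it equals $1$; $\phi^{-1}(a)=\{y'\mid\phi(y')=a\}$. The strict class $\mathcal{GMM}_{m+1}$ in $2m$ variables consists of all functions $f\colon\mathbb{F}_2^{m-1}\times\mathbb{F}_2^{m+1}\to\mathbb{F}_2$ of the form $f(x',y')=x'\cdot\phi(y')+h(y')$ with $\phi\colon\mathbb{F}_2^{m+1}\to\mathbb{F}_2^{m-1}$, $h\colon\mathbb{F}_2^{m+1}\to\mathbb{F}_2$. The strict Maiorana-McFarland class $\mathcal{M}$ in $2m$ variables consists of all functions $f\colon\mathbb{F}_2^m\times\mathbb{F}_2^m\to\mathbb{F}_2$ of the form $f(x,y)=x\cdot\pi(y)+g(y)$ with $\pi$ a permutation of $\mathbb{F}_2^m$ and $g$ an arbitrary Boolean function on $\mathbb{F}_2^m$. Both $\mathbb{F}_2^{m-1}\times\mathbb{F}_2^{m+1}$ and $\mathbb{F}_2^m\times\mathbb{F}_2^m$ are identified with $\mathbb{F}_2^{2m}$ by listing coordinates in order: with $x=(x_1,\ldots,x_m)$ and $y=(y_1,\ldots,y_m)$, one has $x'=(x_1,\ldots,x_{m-1})$ and $y'=(x_m,y_1,\ldots,y_m)$.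 *)

theory Defs
  imports
    "HOL-Library.Z2"
    "HOL-Library.Disjoint_Sets"
    "Jordan_Normal_Form.VS_Connect"
begin

text \<open>
  The space $\mathbb{F}_2^n$ is \<^term>\<open>carrier_vec n :: bit vec set\<close>.
  A Boolean function on it is a total function on \<^typ>\<open>bit vec\<close> of which only the
  values on \<^term>\<open>carrier_vec n :: bit vec set\<close> matter. A product of two such spaces is
  identified with the space of the summed dimension by \<^const>\<open>append_vec\<close>.
\<close>

definition bent :: "nat \<Rightarrow> (bit vec \<Rightarrow> bit) \<Rightarrow> bool" where
  "bent n f \<longleftrightarrow> even n \<and>
     (\<forall>\<omega> \<in> carrier_vec n.
        (\<Sum>x \<in> carrier_vec n. (- 1 :: int) ^ of_bit (f x + \<omega> \<bullet> x))
          \<in> {2 ^ (n div 2), - (2 ^ (n div 2))})"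

definition weight_on :: "bit vec set \<Rightarrow> (bit vec \<Rightarrow> bit) \<Rightarrow> nat" where
  "weight_on S h = card {y \<in> S. h y = 1}"

definition balanced :: "nat \<Rightarrow> (bit vec \<Rightarrow> bit) \<Rightarrow> bool" where
  "balanced n h \<longleftrightarrow> card {y \<in> carrier_vec n. h y = 0} = card {y \<in> carrier_vec n. h y = 1}"

definition permutation_of_space :: "nat \<Rightarrow> (bit vec \<Rightarrow> bit vec) \<Rightarrow> bool" where
  "permutation_of_space n \<pi> \<longleftrightarrow> bij_betw \<pi> (carrier_vec n) (carrier_vec n)"

definition fiber :: "nat \<Rightarrow> (bit vec \<Rightarrow> bit vec) \<Rightarrow> bit vec \<Rightarrow> bit vec set" where
  "fiber n \<phi> a = {y \<in> carrier_vec n. \<phi> y = a}"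

definition affine_subspace_of_dim :: "nat \<Rightarrow> nat \<Rightarrow> bit vec set \<Rightarrow> bool" where
  "affine_subspace_of_dim n d A \<longleftrightarrow>
     (\<exists>W. \<exists>a \<in> carrier_vec n.
        VectorSpace.subspace class_ring W (module_vec TYPE(bit) n) \<and>
        vectorspace.dim class_ring (module_vec TYPE(bit) n \<lparr>carrier := W\<rparr>) = d \<and>
        A = (\<lambda>w. a + w) ` W)"

definition gmm_rep ::
  "nat \<Rightarrow> (bit vec \<Rightarrow> bit) \<Rightarrow> (bit vec \<Rightarrow> bit vec) \<Rightarrow> (bit vec \<Rightarrow> bit) \<Rightarrow> bool" where
  "gmm_rep m f \<phi> h \<longleftrightarrow>
     \<phi> \<in> carrier_vec (m + 1) \<rightarrow> carrier_vec (m - 1) \<and>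
     (\<forall>x' \<in> carrier_vec (m - 1). \<forall>y' \<in> carrier_vec (m + 1).
        f (x' @\<^sub>v y') = x' \<bullet> \<phi> y' + h y')"

text \<open>
  The strict classes $\mathcal{GMM}_{m+1}$ and $\mathcal{M}$ in $2m$ variables, for $m \geq 1$.
\<close>

definition GMM :: "nat \<Rightarrow> (bit vec \<Rightarrow> bit) set" where
  "GMM m = {f. \<exists>\<phi> h. gmm_rep m f \<phi> h}"

definition MM :: "nat \<Rightarrow> (bit vec \<Rightarrow> bit) set" where
  "MM m = {f. \<exists>\<pi> g. permutation_of_space m \<pi> \<and>
     (\<forall>x \<in> carrier_vec m. \<forall>y \<in> carrier_vec m. f (x @\<^sub>v y) = x \<bullet> \<pi> y + g y)}"

end

theory Submission
  imports Defs "Jordan_Normal_Form.DL_Rank"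
begin

text \<open>
  Split off the last coordinate of the first block: with \<open>x = (x', c)\<close> and
  \<open>\<pi> y = (\<phi> y, q y)\<close> one has \<open>x \<bullet> \<pi> y + g y = x' \<bullet> \<phi> y + (c * q y + g y)\<close>. Hence a
  representation in \<open>\<M>\<close> is the same thing as a representation in \<open>\<G>\<M>\<M>\<close> whose \<open>\<phi>\<close> ignores \<open>c\<close>, the
  coefficient of \<open>c\<close> in \<open>h\<close> being \<open>q = h'\<close>. Each fiber of \<open>\<phi>\<close> is then a cylinder
  \<open>{0, 1} \<times> {y\<^sub>0, y\<^sub>1}\<close> with \<open>q y\<^sub>0 = 0\<close> and \<open>q y\<^sub>1 = 1\<close>; on it \<open>h\<close> is constant in \<open>c\<close> over
  \<open>y\<^sub>0\<close> and non-constant over \<open>y\<^sub>1\<close>, so its weight is odd.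
\<close>

section \<open>Span, independence and dimension for two vectors\<close>

context vec_space
begin

text \<open>Distinctness is what makes both summands appear: for \<open>u = v\<close> the set
  \<open>{u, v}\<close> has one element and the combination a single term.\<close>

lemma lincomb_pair:
  assumes "u \<in> carrier_vec n" "v \<in> carrier_vec n" "u \<noteq> v"
  shows "lincomb c {u, v} = c u \<cdot>\<^sub>v u + c v \<cdot>\<^sub>v v"
proof (rule eq_vecI)
  show "dim_vec (lincomb c {u, v}) = dim_vec (c u \<cdot>\<^sub>v u + c v \<cdot>\<^sub>v v)"
    using lincomb_dim[of "{u, v}" c] assms by auto
next
  fix i assume "i < dim_vec (c u \<cdot>\<^sub>v u + c v \<cdot>\<^sub>v v)"
  then have i: "i < n"
    using assms by simp
  show "lincomb c {u, v} $ i = (c u \<cdot>\<^sub>v u + c v \<cdot>\<^sub>v v) $ i"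
    using lincomb_index[OF i, of "{u, v}" c] assms i by (simp add: carrier_vecD)
qed

lemma span_pair:
  assumes "u \<in> carrier_vec n" "v \<in> carrier_vec n" "u \<noteq> v"
  shows "span {u, v} = {a \<cdot>\<^sub>v u + b \<cdot>\<^sub>v v | a b. True}"
proof -
  have "span {u, v} = {lincomb c {u, v} | c. True}"
    using finite_span[of "{u, v}"] assms by (auto simp: class_ring_simps)
  also have "\<dots> = {c u \<cdot>\<^sub>v u + c v \<cdot>\<^sub>v v | c. True}"
    using lincomb_pair[OF assms] by simp
  also have "\<dots> = {a \<cdot>\<^sub>v u + b \<cdot>\<^sub>v v | a b. True}"
  proof (intro equalityI subsetI)
    fix w assume "w \<in> {a \<cdot>\<^sub>v u + b \<cdot>\<^sub>v v | a b. True}"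
    then obtain a b where "w = a \<cdot>\<^sub>v u + b \<cdot>\<^sub>v v"
      by blast
    then show "w \<in> {c u \<cdot>\<^sub>v u + c v \<cdot>\<^sub>v v | c. True}"
      \<comment> \<open>As \<open>u\<close> and \<open>v\<close> differ, one coefficient function
        can take the value \<open>a\<close> at \<open>u\<close> and \<open>b\<close> elsewhere, in
        particular at \<open>v\<close>.\<close>
      using assms by (intro CollectI exI[of _ "\<lambda>x. if x = u then a else b"]) simp
  qed blast
  finally show ?thesis .
qed

lemma lin_indpt_pair:
  assumes "u \<in> carrier_vec n" "v \<in> carrier_vec n" "u \<noteq> v"
    and indep: "\<And>a b. a \<cdot>\<^sub>v u + b \<cdot>\<^sub>v v = 0\<^sub>v n \<Longrightarrow> a = 0 \<and> b = 0"
  shows "lin_indpt {u, v}"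
proof (rule finite_lin_indpt2)
  fix c assume "lincomb c {u, v} = 0\<^sub>v n"
  then have "c u = 0 \<and> c v = 0"
    using lincomb_pair[OF assms(1-3)] indep by simp
  then show "\<forall>w\<in>{u, v}. c w = 0"
    by simp
qed (use assms in auto)

text \<open>An independent \<open>S\<close> is itself a maximal independent subset of
  \<open>S\<close>, so \<open>dim_span\<close> applies with \<open>S\<close> as the basis.\<close>

lemma dim_span_lin_indpt:
  assumes "finite S" "S \<subseteq> carrier_vec n" "lin_indpt S"
  shows "vectorspace.dim class_ring (span_vs S) = card S"
  by (rule dim_span) (use assms in \<open>auto simp: maximal_def\<close>)

end

section \<open>Cylinders over two points as affine planes\<close>

lemma ex_bit: "(\<exists>c :: bit. P c) \<longleftrightarrow> P 0 \<or> P 1"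
  by (metis bit.exhaust)

text \<open>The base point is \<open>(0, y\<^sub>0)\<close>. The direction space is spanned by the
  first unit vector \<open>u\<close>, which flips the head, and by \<open>v\<close>, whose tail
  \<open>y\<^sub>0 + y\<^sub>1\<close> is the difference of the two points in characteristic
  2.\<close>

lemma affine_subspace_cylinder:
  assumes "y\<^sub>0 \<in> carrier_vec n" "y\<^sub>1 \<in> carrier_vec n" "y\<^sub>0 \<noteq> y\<^sub>1"
  shows "affine_subspace_of_dim (Suc n) 2 {vCons c y | c y. y \<in> {y\<^sub>0, y\<^sub>1}}"
proof -
  interpret vec_space "TYPE(bit)" "Suc n" .
  define u v :: "bit vec" where "u = vCons 1 (0\<^sub>v n)" and "v = vCons 0 (y\<^sub>0 + y\<^sub>1)"
  have uv: "u \<in> carrier_vec (Suc n)" "v \<in> carrier_vec (Suc n)" "u \<noteq> v"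
    using assms by (auto simp: u_def v_def)
  \<comment> \<open>At a coordinate where the two points differ,
    \<open>y\<^sub>0 + y\<^sub>1\<close> has entry 1; this entry forces \<open>b = 0\<close> in a
    vanishing combination.\<close>
  obtain i where i: "i < n" "y\<^sub>0 $ i \<noteq> y\<^sub>1 $ i"
    using assms by (metis carrier_vecD eq_vecI)
  have comb: "a \<cdot>\<^sub>v u + b \<cdot>\<^sub>v v = vCons a (b \<cdot>\<^sub>v (y\<^sub>0 + y\<^sub>1))" for a b
    by (rule eq_vecI) (use assms in \<open>auto simp: u_def v_def vec_index_vCons simp del: add_bit_eq_xor\<close>)
  have "lin_indpt {u, v}"
  proof (rule lin_indpt_pair[OF uv])
    fix a b assume "a \<cdot>\<^sub>v u + b \<cdot>\<^sub>v v = 0\<^sub>v (Suc n)"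
    then have "a = 0" and *: "b \<cdot>\<^sub>v (y\<^sub>0 + y\<^sub>1) = 0\<^sub>v n"
      by (simp_all add: comb zero_vec_Suc)
    from * have "(b \<cdot>\<^sub>v (y\<^sub>0 + y\<^sub>1)) $ i = 0"
      using i by simp
    then have "b = 0"
      using i assms by (cases "y\<^sub>0 $ i"; cases "y\<^sub>1 $ i") auto
    with \<open>a = 0\<close> show "a = 0 \<and> b = 0" by simp
  qed
  then have dim: "vectorspace.dim class_ring (span_vs {u, v}) = 2"
    using dim_span_lin_indpt[of "{u, v}"] uv by simp
  have sub: "VectorSpace.subspace class_ring (span {u, v}) (module_vec TYPE(bit) (Suc n))"
    using span_is_subspace[of "{u, v}"] uv by simp
  \<comment> \<open>The two coefficients act separately: \<open>a\<close> becomes the head, and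
    \<open>b\<close> decides whether the tail moves, since
    \<open>y\<^sub>0 + (y\<^sub>0 + y\<^sub>1) = y\<^sub>1\<close> over the two-element
    field.\<close>
  have shift: "vCons 0 y\<^sub>0 + (a \<cdot>\<^sub>v u + b \<cdot>\<^sub>v v) = vCons a (if b = 0 then y\<^sub>0 else y\<^sub>1)" for a b
  proof -
    have "y\<^sub>0 + b \<cdot>\<^sub>v (y\<^sub>0 + y\<^sub>1) = (if b = 0 then y\<^sub>0 else y\<^sub>1)"
      by (rule eq_vecI; cases b) (use assms in auto)
    moreover have "vCons 0 y\<^sub>0 + vCons a w = vCons a (y\<^sub>0 + w)" if "w \<in> carrier_vec n" for w
      by (rule eq_vecI) (use assms that in \<open>auto simp: vec_index_vCons simp del: add_bit_eq_xor\<close>)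
    ultimately show ?thesis
      using assms by (simp add: comb)
  qed
  have "{vCons c y | c y. y \<in> {y\<^sub>0, y\<^sub>1}} = (\<lambda>w. vCons 0 y\<^sub>0 + w) ` span {u, v}"
  proof -
    have "(\<lambda>w. vCons 0 y\<^sub>0 + w) ` span {u, v}
        = {vCons 0 y\<^sub>0 + (a \<cdot>\<^sub>v u + b \<cdot>\<^sub>v v) | a b. True}"
      unfolding span_pair[OF uv] by blast
    also have "\<dots> = {vCons a (if b = (0::bit) then y\<^sub>0 else y\<^sub>1) | a b. True}"
      by (simp only: shift)
    also have "\<dots> = {vCons c y | c y. y \<in> {y\<^sub>0, y\<^sub>1}}"
      by (auto simp: ex_bit)
    finally show ?thesis by simp
  qed
  then show ?thesis
    unfolding affine_subspace_of_dim_def using sub dim assms by fastforce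
qed

section \<open>One coordinate read as the end of the first block or as the head of the
  second\<close>

lemma append_vec_singleton_append: "(x @\<^sub>v vec_of_list [c]) @\<^sub>v y = x @\<^sub>v vCons c y"
  by (induction x) simp_all

lemma scalar_prod_append_singleton:
  assumes "x \<in> carrier_vec k" "p \<in> carrier_vec k"
  shows "(x @\<^sub>v vec_of_list [c]) \<bullet> (p @\<^sub>v vec_of_list [q]) = x \<bullet> p + c * q"
  using scalar_prod_append[of x k "vec_of_list [c]" 1 p "vec_of_list [q]"] assms by simp

lemma append_singleton_carrier:
  "x \<in> carrier_vec k \<Longrightarrow> x @\<^sub>v vec_of_list [c] \<in> carrier_vec (Suc k)"
  using append_carrier_vec[of x k "vec_of_list [c]" 1] by simp

lemma append_singleton_eq:
  assumes "x \<in> carrier_vec k" "y \<in> carrier_vec k"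
  shows "x @\<^sub>v vec_of_list [c] = y @\<^sub>v vec_of_list [d] \<longleftrightarrow> x = y \<and> c = d"
  by (simp add: append_vec_eq[OF assms])

lemma append_singleton_cases:
  assumes "x \<in> carrier_vec (Suc k)"
  obtains x' c where "x' \<in> carrier_vec k" "x = x' @\<^sub>v vec_of_list [c]"
proof
  show "vec_first x k \<in> carrier_vec k" by simp
  show "x = vec_first x k @\<^sub>v vec_of_list [x $ k]"
    by (rule eq_vecI) (use assms in \<open>auto simp: vec_first_def less_Suc_eq\<close>)
qed

lemma carrier_vec_Suc_cases:
  assumes "z \<in> carrier_vec (Suc k)"
  obtains c y where "y \<in> carrier_vec k" "z = vCons c y"
proof (cases z)
  case vNil
  then show thesis
    using carrier_vecD[OF assms] by simp
next
  case (vCons c y)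
  with assms show thesis
    using that[of y c] by (simp only: vCons_carrier_vec)
qed

section \<open>Level sets and fibers of a map that one more bit extends to a permutation\<close>

lemma permutation_extension_ex1:
  assumes p: "\<And>y. y \<in> carrier_vec (Suc k) \<Longrightarrow> p y \<in> carrier_vec k"
    and perm: "permutation_of_space (Suc k) (\<lambda>y. p y @\<^sub>v vec_of_list [q y])"
    and a: "a \<in> carrier_vec k"
  shows "\<exists>!y. y \<in> carrier_vec (Suc k) \<and> p y = a \<and> q y = b"
proof -
  let ?\<pi> = "\<lambda>y. p y @\<^sub>v vec_of_list [q y]"
  have inj: "inj_on ?\<pi> (carrier_vec (Suc k))" and surj: "?\<pi> ` carrier_vec (Suc k) = carrier_vec (Suc k)"
    using perm unfolding permutation_of_space_def bij_betw_def by blast+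
  \<comment> \<open>The wanted \<open>y\<close> is the preimage of the vector \<open>(a, b)\<close>
    under the permutation.\<close>
  have "a @\<^sub>v vec_of_list [b] \<in> ?\<pi> ` carrier_vec (Suc k)"
    unfolding surj by (rule append_singleton_carrier[OF a])
  then obtain y where y: "y \<in> carrier_vec (Suc k)" and eq: "a @\<^sub>v vec_of_list [b] = ?\<pi> y"
    by (rule imageE)
  show ?thesis
  proof (rule ex1I)
    show "y \<in> carrier_vec (Suc k) \<and> p y = a \<and> q y = b"
      using y eq unfolding append_singleton_eq[OF a p[OF y]] by blast
    fix z assume z: "z \<in> carrier_vec (Suc k) \<and> p z = a \<and> q z = b"
    then have "?\<pi> z = ?\<pi> y"
      by (simp only: eq)
    then show "z = y"
      using inj_onD[OF inj] z y by blast
  qed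
qed

text \<open>For either bit \<open>b\<close>, the map \<open>p\<close> is a bijection from the level
  set \<open>q y = b\<close> onto the whole space of dimension \<open>k\<close>, so the two level
  sets have the same size.\<close>

lemma balanced_if_extends_to_permutation:
  assumes p: "\<And>y. y \<in> carrier_vec (Suc k) \<Longrightarrow> p y \<in> carrier_vec k"
    and perm: "permutation_of_space (Suc k) (\<lambda>y. p y @\<^sub>v vec_of_list [q y])"
  shows "balanced (Suc k) q"
proof -
  note ex1 = permutation_extension_ex1[where p = p and q = q, OF p perm]
  have "card {y \<in> carrier_vec (Suc k). q y = b} = card (carrier_vec k :: bit vec set)" for b
  proof (rule bij_betw_same_card[of p], unfold bij_betw_def, intro conjI)
    show "inj_on p {y \<in> carrier_vec (Suc k). q y = b}"
    proof (rule inj_onI)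
      fix y z assume "y \<in> {y \<in> carrier_vec (Suc k). q y = b}" "z \<in> {y \<in> carrier_vec (Suc k). q y = b}"
        "p y = p z"
      then show "y = z"
        using ex1[of "p z" b] p[of z] by blast
    qed
    show "p ` {y \<in> carrier_vec (Suc k). q y = b} = carrier_vec k"
    proof (intro equalityI subsetI)
      fix a :: "bit vec" assume "a \<in> carrier_vec k"
      then show "a \<in> p ` {y \<in> carrier_vec (Suc k). q y = b}"
        using ex1[of a b] by blast
    next
      fix a :: "bit vec" assume "a \<in> p ` {y \<in> carrier_vec (Suc k). q y = b}"
      then show "a \<in> carrier_vec k"
        using p by blast
    qed
  qed
  then show ?thesis
    unfolding balanced_def by metis
qed

text \<open>The permutation takes the values \<open>(a, 0)\<close> and \<open>(a, 1)\<close> once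
  each, at \<open>y\<^sub>0\<close> and \<open>y\<^sub>1\<close>; these are the only points where
  \<open>p\<close> equals \<open>a\<close>. The head \<open>c\<close> stays free because
  \<open>\<phi>\<close> ignores it.\<close>

lemma fiber_eq_cylinder:
  assumes p: "\<And>y. y \<in> carrier_vec (Suc k) \<Longrightarrow> p y \<in> carrier_vec k"
    and perm: "permutation_of_space (Suc k) (\<lambda>y. p y @\<^sub>v vec_of_list [q y])"
    and \<phi>: "\<And>c y. y \<in> carrier_vec (Suc k) \<Longrightarrow> \<phi> (vCons c y) = p y"
    and a: "a \<in> carrier_vec k"
  obtains y\<^sub>0 y\<^sub>1 where "y\<^sub>0 \<in> carrier_vec (Suc k)" "y\<^sub>1 \<in> carrier_vec (Suc k)"
    "q y\<^sub>0 = 0" "q y\<^sub>1 = 1" "fiber (Suc (Suc k)) \<phi> a = {vCons c y | c y. y \<in> {y\<^sub>0, y\<^sub>1}}"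
proof -
  note ex1 = permutation_extension_ex1[where p = p and q = q, OF p perm a]
  obtain y\<^sub>0 where y\<^sub>0: "y\<^sub>0 \<in> carrier_vec (Suc k)" "p y\<^sub>0 = a" "q y\<^sub>0 = 0"
    using ex1[of 0] by blast
  obtain y\<^sub>1 where y\<^sub>1: "y\<^sub>1 \<in> carrier_vec (Suc k)" "p y\<^sub>1 = a" "q y\<^sub>1 = 1"
    using ex1[of 1] by blast
  have uniq: "y = y\<^sub>0 \<or> y = y\<^sub>1" if y: "y \<in> carrier_vec (Suc k)" "p y = a" for y
  proof (cases "q y")
    case zero
    then show ?thesis using ex1[of 0] y y\<^sub>0 by blast
  next
    case one
    then show ?thesis using ex1[of 1] y y\<^sub>1 by blast
  qed
  have "fiber (Suc (Suc k)) \<phi> a = {vCons c y | c y. y \<in> {y\<^sub>0, y\<^sub>1}}"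
  proof (intro equalityI subsetI)
    fix z assume "z \<in> fiber (Suc (Suc k)) \<phi> a"
    then have "z \<in> carrier_vec (Suc (Suc k))" and z: "\<phi> z = a"
      unfolding fiber_def by blast+
    from this(1) obtain y c where y: "y \<in> carrier_vec (Suc k)" "z = vCons c y"
      by (rule carrier_vec_Suc_cases)
    with z \<phi> have "p y = a"
      by metis
    with uniq y show "z \<in> {vCons c y | c y. y \<in> {y\<^sub>0, y\<^sub>1}}"
      by blast
  next
    fix z assume "z \<in> {vCons c y | c y. y \<in> {y\<^sub>0, y\<^sub>1}}"
    then obtain c y where "z = vCons c y" "y \<in> carrier_vec (Suc k)" "p y = a"
      using y\<^sub>0 y\<^sub>1 by blast
    then show "z \<in> fiber (Suc (Suc k)) \<phi> a"
      unfolding fiber_def by (simp only: vCons_carrier_vec \<phi> mem_Collect_eq)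
  qed
  with y\<^sub>0 y\<^sub>1 show thesis
    using that by blast
qed

text \<open>The two points over \<open>y\<^sub>0\<close> contribute 0 or 2 to the weight, those over
  \<open>y\<^sub>1\<close> exactly 1.\<close>

lemma odd_weight_on_cylinder:
  assumes "y\<^sub>0 \<noteq> y\<^sub>1" "h (vCons 0 y\<^sub>0) = h (vCons 1 y\<^sub>0)" "h (vCons 0 y\<^sub>1) \<noteq> h (vCons 1 y\<^sub>1)"
  shows "odd (weight_on {vCons c y | c y. y \<in> {y\<^sub>0, y\<^sub>1}} h)"
proof -
  have cyl: "{vCons c y | c y. y \<in> {y\<^sub>0, y\<^sub>1}}
      = {vCons 0 y\<^sub>0, vCons 1 y\<^sub>0, vCons 0 y\<^sub>1, vCons (1::bit) y\<^sub>1}"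
    by (auto simp: ex_bit)
  have "{z \<in> {vCons c y | c y. y \<in> {y\<^sub>0, y\<^sub>1}}. h z = 1}
      = (if h (vCons 1 y\<^sub>0) = 1 then {vCons 0 y\<^sub>0, vCons 1 y\<^sub>0} else {})
        \<union> {vCons (if h (vCons 0 y\<^sub>1) = 1 then 0 else 1) y\<^sub>1}"
    unfolding cyl using assms
    by (cases "h (vCons 1 y\<^sub>0)"; cases "h (vCons 0 y\<^sub>1)"; cases "h (vCons 1 y\<^sub>1)") auto
  then show ?thesis
    using assms(1) by (simp add: weight_on_def)
qed

section \<open>Passing between the two representations of \<open>f\<close>\<close>

theorem proposition5p11:
  fixes m :: nat and f :: "bit vec \<Rightarrow> bit"
  assumes "m \<ge> 1"
    and "f \<in> GMM m"
    and "bent (2 * m) f"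
  shows "f \<in> MM m \<longleftrightarrow>
    (\<exists>(\<phi> :: bit vec \<Rightarrow> bit vec) (h :: bit vec \<Rightarrow> bit).
       gmm_rep m f \<phi> h \<and>
       partition_on (carrier_vec (m + 1)) {fiber (m + 1) \<phi> a | a. a \<in> carrier_vec (m - 1)} \<and>
       (\<forall>a \<in> carrier_vec (m - 1). affine_subspace_of_dim (m + 1) 2 (fiber (m + 1) \<phi> a)) \<and>
       (\<forall>a \<in> carrier_vec (m - 1). odd (weight_on (fiber (m + 1) \<phi> a) h)) \<and>
       (\<forall>y \<in> carrier_vec m. \<phi> (vCons 0 y) = \<phi> (vCons 1 y)) \<and>
       (let h' = (\<lambda>y. h (vCons 0 y) + h (vCons 1 y)) in
          balanced m h' \<and>
          permutation_of_space m (\<lambda>y. \<phi> (vCons 0 y) @\<^sub>v vec_of_list [h' y])))"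
    (is "_ \<longleftrightarrow> (\<exists>\<phi> h. ?cond \<phi> h)")
proof -
  \<comment> \<open>With \<open>m = Suc k\<close> the truncated difference \<open>m - 1\<close> is
    exactly \<open>k\<close>, and the first block of length \<open>m\<close> has a last coordinate,
    at index \<open>k\<close>.\<close>
  obtain k where m: "m = Suc k"
    using assms(1) by (cases m) auto
  show ?thesis
  proof
    assume "f \<in> MM m"
    then obtain \<pi> g where \<pi>: "permutation_of_space (Suc k) \<pi>"
      and f: "\<And>x y. x \<in> carrier_vec (Suc k) \<Longrightarrow> y \<in> carrier_vec (Suc k) \<Longrightarrow> f (x @\<^sub>v y) = x \<bullet> \<pi> y + g y"
      unfolding MM_def m by blast
    define p where "p y = vec_first (\<pi> y) k" for y
    define q where "q y = \<pi> y $ k" for y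
    \<comment> \<open>On a vector of length \<open>k + 2\<close>, \<open>vec_last\<close> drops the
      head and leaves \<open>y\<close>; the head \<open>z $ 0\<close> is the coordinate moved over
      from the first block.\<close>
    define \<phi> where "\<phi> z = p (vec_last z (Suc k))" for z
    define h where "h z = z $ 0 * q (vec_last z (Suc k)) + g (vec_last z (Suc k))" for z
    have p: "p y \<in> carrier_vec k" for y
      by (simp add: p_def)
    have \<pi>_eq: "\<pi> y = p y @\<^sub>v vec_of_list [q y]" if "y \<in> carrier_vec (Suc k)" for y
    proof -
      have "\<pi> y \<in> carrier_vec (Suc k)"
        using \<pi> that unfolding permutation_of_space_def bij_betw_def by blast
      then show ?thesis
        by (intro eq_vecI) (auto simp: p_def q_def vec_first_def less_Suc_eq)
    qed
    have perm: "permutation_of_space (Suc k) (\<lambda>y. p y @\<^sub>v vec_of_list [q y])"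
      using \<pi> unfolding permutation_of_space_def by (simp only: bij_betw_cong[OF \<pi>_eq])
    have last: "vec_last (vCons c y) (Suc k) = y" if "y \<in> carrier_vec (Suc k)" for c :: bit and y
      by (rule eq_vecI) (use that in \<open>auto simp: vec_last_def\<close>)
    have \<phi>: "\<phi> (vCons c y) = p y" and h: "h (vCons c y) = c * q y + g y"
      if "y \<in> carrier_vec (Suc k)" for c y
      using last[OF that] by (simp_all add: \<phi>_def h_def)
    \<comment> \<open>The two copies of \<open>g y\<close> cancel in characteristic 2, leaving the
      coefficient of the head.\<close>
    have h': "h (vCons 0 y) + h (vCons 1 y) = q y" if "y \<in> carrier_vec (Suc k)" for y
      using h[OF that] by (cases "q y"; cases "g y") simp_all
    have "gmm_rep m f \<phi> h"
      unfolding gmm_rep_def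
    proof (intro conjI ballI)
      show "\<phi> \<in> carrier_vec (m + 1) \<rightarrow> carrier_vec (m - 1)"
        using p by (simp add: \<phi>_def m)
      fix x' y' :: "bit vec"
      assume x': "x' \<in> carrier_vec (m - 1)" and "y' \<in> carrier_vec (m + 1)"
      then have "y' \<in> carrier_vec (Suc (Suc k))"
        using m by simp
      then obtain y c where y: "y \<in> carrier_vec (Suc k)" "y' = vCons c y"
        by (rule carrier_vec_Suc_cases)
      from x' have x'_car: "x' \<in> carrier_vec k"
        using m by simp
      have "f (x' @\<^sub>v y') = f ((x' @\<^sub>v vec_of_list [c]) @\<^sub>v y)"
        by (simp only: append_vec_singleton_append y)
      also have "\<dots> = (x' @\<^sub>v vec_of_list [c]) \<bullet> (p y @\<^sub>v vec_of_list [q y]) + g y"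
        by (simp only: f[OF append_singleton_carrier[OF x'_car] y(1)] \<pi>_eq[OF y(1)])
      also have "\<dots> = x' \<bullet> p y + c * q y + g y"
        by (simp only: scalar_prod_append_singleton[OF x'_car p])
      finally show "f (x' @\<^sub>v y') = x' \<bullet> \<phi> y' + h y'"
        by (simp only: y(2) \<phi>[OF y(1)] h[OF y(1)] add.assoc)
    qed
    \<comment> \<open>Nonemptiness is proved along with the rest because the blocks of a partition
      must be nonempty.\<close>
    moreover have "affine_subspace_of_dim (m + 1) 2 (fiber (m + 1) \<phi> a) \<and>
        odd (weight_on (fiber (m + 1) \<phi> a) h) \<and> fiber (m + 1) \<phi> a \<noteq> {}"
      if "a \<in> carrier_vec (m - 1)" for a
    proof -
      have a: "a \<in> carrier_vec k"
        using that m by simp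
      obtain y\<^sub>0 y\<^sub>1 where y: "y\<^sub>0 \<in> carrier_vec (Suc k)" "y\<^sub>1 \<in> carrier_vec (Suc k)"
        "q y\<^sub>0 = 0" "q y\<^sub>1 = 1" and fib: "fiber (Suc (Suc k)) \<phi> a = {vCons c y | c y. y \<in> {y\<^sub>0, y\<^sub>1}}"
        by (rule fiber_eq_cylinder[of k p q \<phi> a, OF p perm \<phi> a])
      have ne: "y\<^sub>0 \<noteq> y\<^sub>1"
        using y by auto
      have "h (vCons 0 y\<^sub>0) = h (vCons 1 y\<^sub>0)" "h (vCons 0 y\<^sub>1) \<noteq> h (vCons 1 y\<^sub>1)"
        using y h by (simp, cases "g y\<^sub>1") simp_all
      then show ?thesis
        using affine_subspace_cylinder[OF y(1,2) ne] odd_weight_on_cylinder[of y\<^sub>0 y\<^sub>1 h, OF ne]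
        by (auto simp: m fib)
    qed
    moreover from this
    have "partition_on (carrier_vec (m + 1)) {fiber (m + 1) \<phi> a | a. a \<in> carrier_vec (m - 1)}"
      using p by (intro partition_onI) (auto simp: fiber_def \<phi>_def m disjnt_def)
    moreover have "\<phi> (vCons 0 y) = \<phi> (vCons 1 y)" if "y \<in> carrier_vec m" for y
      using that \<phi> m by simp
    moreover have perm': "permutation_of_space m
        (\<lambda>y. \<phi> (vCons 0 y) @\<^sub>v vec_of_list [h (vCons 0 y) + h (vCons 1 y)])"
    proof -
      \<comment> \<open>On the space itself, the extension of \<open>\<phi>\<close> by
        \<open>h'\<close> is the original permutation \<open>\<pi>\<close>, split into
        \<open>p\<close> and \<open>q\<close>.\<close>
      have cong: "p y @\<^sub>v vec_of_list [q y]
          = \<phi> (vCons 0 y) @\<^sub>v vec_of_list [h (vCons 0 y) + h (vCons 1 y)]"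
        if "y \<in> carrier_vec (Suc k)" for y
        by (simp only: h'[OF that] \<phi>[OF that])
      have "permutation_of_space (Suc k) (\<lambda>y. p y @\<^sub>v vec_of_list [q y]) \<longleftrightarrow> ?thesis"
        unfolding permutation_of_space_def m by (rule bij_betw_cong) (rule cong)
      with perm show ?thesis
        by (rule iffD1[rotated])
    qed
    moreover have "balanced m (\<lambda>y. h (vCons 0 y) + h (vCons 1 y))"
      unfolding m
      by (rule balanced_if_extends_to_permutation[OF _ perm'[unfolded m]]) (simp only: \<phi> p)
    ultimately have "?cond \<phi> h"
      by (simp add: Let_def)
    then show "\<exists>\<phi> h. ?cond \<phi> h"
      by blast
  next
    assume "\<exists>\<phi> h. ?cond \<phi> h"
    then obtain \<phi> h where rep: "gmm_rep m f \<phi> h"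
      and indep: "\<And>y. y \<in> carrier_vec m \<Longrightarrow> \<phi> (vCons 0 y) = \<phi> (vCons 1 y)"
      and perm: "permutation_of_space m
        (\<lambda>y. \<phi> (vCons 0 y) @\<^sub>v vec_of_list [h (vCons 0 y) + h (vCons 1 y)])"
      unfolding Let_def by blast
    \<comment> \<open>Conditions (1) and (2) supply the data for \<open>MM\<close>: the permutation
      is \<open>\<phi>\<close> extended by \<open>h'\<close>, and \<open>g\<close> is the slice of
      \<open>h\<close> at head 0.\<close>
    let ?\<pi> = "\<lambda>y. \<phi> (vCons 0 y) @\<^sub>v vec_of_list [h (vCons 0 y) + h (vCons 1 y)]"
    have "f (x @\<^sub>v y) = x \<bullet> ?\<pi> y + h (vCons 0 y)"
      if x_car: "x \<in> carrier_vec m" and y: "y \<in> carrier_vec m" for x y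
    proof -
      obtain x' c where x: "x' \<in> carrier_vec k" "x = x' @\<^sub>v vec_of_list [c]"
        by (rule append_singleton_cases[OF x_car[unfolded m]])
      have z: "vCons b y \<in> carrier_vec (m + 1)" for b
        using y by simp
      have "\<phi> \<in> carrier_vec (m + 1) \<rightarrow> carrier_vec (m - 1)"
        and f: "\<And>x' y'. x' \<in> carrier_vec (m - 1) \<Longrightarrow> y' \<in> carrier_vec (m + 1)
          \<Longrightarrow> f (x' @\<^sub>v y') = x' \<bullet> \<phi> y' + h y'"
        using rep unfolding gmm_rep_def by blast+
      from funcset_mem[OF this(1) z] have car: "\<phi> (vCons 0 y) \<in> carrier_vec k"
        by (simp add: m)
      have "f (x @\<^sub>v y) = f (x' @\<^sub>v vCons c y)"
        by (simp only: x(2) append_vec_singleton_append)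
      also have "\<dots> = x' \<bullet> \<phi> (vCons c y) + h (vCons c y)"
        by (rule f[OF _ z]) (simp add: x m)
      also have "\<phi> (vCons c y) = \<phi> (vCons 0 y)"
        using indep[OF y] by (cases c) simp_all
      \<comment> \<open>Any function of one bit is affine in it: its slope is the sum of its two
        values, here \<open>h' y\<close>, and its constant term the value at 0.\<close>
      also have "h (vCons c y) = c * (h (vCons 0 y) + h (vCons 1 y)) + h (vCons 0 y)"
        by (cases c; cases "h (vCons 0 y)"; cases "h (vCons 1 y)") simp_all
      finally show ?thesis
        unfolding x(2) scalar_prod_append_singleton[OF x(1) car] by (simp only: add.assoc)
    qed
    with perm show "f \<in> MM m"
      unfolding MM_def by (intro CollectI exI[of _ ?\<pi>] exI[of _ "\<lambda>y. h (vCons 0 y)"]) blast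
  qed
qed

end
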